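(* Let $X$ be a real Banach space with topological dual $X^*$. For a set-valued operator $T:X\rightrightarrows X^*$, the following conditions are equivalent: (i) $T$ is paramonotone and bimonotone; (ii) $T$ is monotone and constant on its domain (that is, $T(x)=T(y)$ for all $x,y\in \mathrm{dom}\,T$); (iii) $(\mathrm{dom}\,T-\mathrm{dom}\,T)\perp(\mathrm{range}\,T-\mathrm{range}\,T)$ and $\mathrm{gph}\,T=\mathrm{dom}\,T\times \mathrm{range}\,T$.
   Context: $\langle\cdot,\cdot\rangle$ denotes the canonical pairing between $X$ and $X^*$. For $T:X\rightrightarrows X^*$: $\mathrm{gph}\,T=\{(x,x^* )\in X\times X^*: x^*\in T(x)\}$, $\mathrm{dom}\,T=\{x\in X: T(x)\neq\emptyset\}$, $\mathrm{range}\,T=\bigcup_{x\in X}T(x)$, and $(-T)(x)=\{-x^*:x^*\in T(x)\}$. $T$ is monotone if $\langle x-y,x^*-y^*\rangle\ge 0$ for all $(x,x^* ),(y,y^* )\in \mathrm{gph}\,T$. $T$ is bimonotone if both $T$ and $-T$ are monotone. $T$ is paramonotone if it is monotone and, whenever $(x,x^* ),(y,y^* )\in\mathrm{gph}\,T$ satisfy $\langle x-y,x^*-y^*\rangle=0$, one has $(x,y^* ),(y,x^* )\in\mathrm{gph}\,T$. For $A\subset X$ and $B\subset X^*$, $A\perp B$ means $\langle x,x^*\rangle=0$ for all $(x,x^* )\in A\times B$. *)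

theory Defs
  imports "HOL-Analysis.Analysis"
begin

type_synonym 'a dual = "'a \<Rightarrow>\<^sub>L real"

type_synonym 'a operator = "'a \<Rightarrow> 'a dual set"

abbreviation pairing :: "'a::real_normed_vector \<Rightarrow> 'a dual \<Rightarrow> real" where
  "pairing x x' \<equiv> blinfun_apply x' x"

definition gph :: "'a::real_normed_vector operator \<Rightarrow> ('a \<times> 'a dual) set" where
  "gph T = {(x, x'). x' \<in> T x}"

definition op_dom :: "'a::real_normed_vector operator \<Rightarrow> 'a set" where
  "op_dom T = {x. T x \<noteq> {}}"

definition op_range :: "'a::real_normed_vector operator \<Rightarrow> 'a dual set" where
  "op_range T = (\<Union>x. T x)"

(* The library's unary minus on sets is the complement, so the pointwise
   negative of a set-valued operator must be written as an image. *)
definition op_neg :: "'a::real_normed_vector operator \<Rightarrow> 'a operator" where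
  "op_neg T = (\<lambda>x. uminus ` T x)"

definition monotone_op :: "'a::real_normed_vector operator \<Rightarrow> bool" where
  "monotone_op T \<longleftrightarrow>
     (\<forall>(x, x') \<in> gph T. \<forall>(y, y') \<in> gph T. 0 \<le> pairing (x - y) (x' - y'))"

definition bimonotone_op :: "'a::real_normed_vector operator \<Rightarrow> bool" where
  "bimonotone_op T \<longleftrightarrow> monotone_op T \<and> monotone_op (op_neg T)"

definition paramonotone_op :: "'a::real_normed_vector operator \<Rightarrow> bool" where
  "paramonotone_op T \<longleftrightarrow> monotone_op T \<and>
     (\<forall>(x, x') \<in> gph T. \<forall>(y, y') \<in> gph T.
        pairing (x - y) (x' - y') = 0 \<longrightarrow> (x, y') \<in> gph T \<and> (y, x') \<in> gph T)"

definition constant_on_dom :: "'a::real_normed_vector operator \<Rightarrow> bool" where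
  "constant_on_dom T \<longleftrightarrow> (\<forall>x \<in> op_dom T. \<forall>y \<in> op_dom T. T x = T y)"

(* The algebraic (Minkowski) difference; the library's minus on sets is
   relative complement. *)
definition alg_diff :: "'b::ab_group_add set \<Rightarrow> 'b set \<Rightarrow> 'b set" where
  "alg_diff A B = {a - b | a b. a \<in> A \<and> b \<in> B}"

definition perp :: "'a::real_normed_vector set \<Rightarrow> 'a dual set \<Rightarrow> bool" where
  "perp A B \<longleftrightarrow> (\<forall>(x, x') \<in> A \<times> B. pairing x x' = 0)"

end

theory Submission
  imports Defs
begin

text \<open>
  The conditions are linked by the vanishing of \<open>\<langle>x - y, x' - y'\<rangle>\<close>. Bimonotonicity bounds this number
  from both sides on the graph, so that it is zero there (\<open>bimonotone_op_iff_pairing_zero\<close>), and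
  paramonotonicity then amounts to free exchange of values between points of the domain, that is, to
  constancy on the domain (\<open>paramonotone_iff_constant_on_dom\<close>). For an operator with that property,
  exchanging \<open>x'\<close> and \<open>y'\<close> stays in the graph but changes the sign of the pairing, so monotonicity
  alone already forces bimonotonicity (\<open>monotone_constant_imp_bimonotone_op\<close>). Hence the first two
  conditions both mean that \<open>T\<close> is bimonotone and constant on its domain. The third says the same:
  constancy is the product form of the graph (\<open>constant_on_dom_iff_gph_product\<close>), and on a product
  graph orthogonality is bimonotonicity (\<open>perp_iff_bimonotone_op\<close>).
\<close>

lemma monotone_op_iff:
  "monotone_op T \<longleftrightarrow>
     (\<forall>x y. \<forall>x' \<in> T x. \<forall>y' \<in> T y. 0 \<le> pairing (x - y) (x' - y'))"
  unfolding monotone_op_def gph_def by blast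

lemma monotone_op_neg_iff:
  "monotone_op (op_neg T) \<longleftrightarrow>
     (\<forall>x y. \<forall>x' \<in> T x. \<forall>y' \<in> T y. pairing (x - y) (x' - y') \<le> 0)"
proof -
  have "0 \<le> pairing (x - y) (- x' - - y') \<longleftrightarrow> pairing (x - y) (x' - y') \<le> 0"
    for x y :: 'a and x' y'
    by (simp add: blinfun.diff_left blinfun.minus_left)
  then show ?thesis
    unfolding monotone_op_iff op_neg_def by (simp only: ball_simps(9))
qed

lemma bimonotone_op_iff_pairing_zero:
  "bimonotone_op T \<longleftrightarrow>
     (\<forall>x y. \<forall>x' \<in> T x. \<forall>y' \<in> T y. pairing (x - y) (x' - y') = 0)"
proof -
  have "bimonotone_op T \<longleftrightarrow> (\<forall>x y. \<forall>x' \<in> T x. \<forall>y' \<in> T y.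
      pairing (x - y) (x' - y') \<le> 0 \<and> 0 \<le> pairing (x - y) (x' - y'))"
    unfolding bimonotone_op_def monotone_op_iff[of T] monotone_op_neg_iff by blast
  then show ?thesis
    by (simp only: order_eq_iff[where ?'a = real])
qed

lemma constant_on_dom_iff_gph_product:
  "constant_on_dom T \<longleftrightarrow> gph T = op_dom T \<times> op_range T"
proof
  assume "constant_on_dom T"
  then show "gph T = op_dom T \<times> op_range T"
    unfolding constant_on_dom_def gph_def op_dom_def op_range_def by blast
next
  assume prod: "gph T = op_dom T \<times> op_range T"
  have "T x = op_range T" if "x \<in> op_dom T" for x
  proof -
    have "x' \<in> T x \<longleftrightarrow> (x, x') \<in> op_dom T \<times> op_range T" for x'
      by (simp add: prod[symmetric] gph_def)
    with that show ?thesis by auto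
  qed
  then show "constant_on_dom T"
    by (simp add: constant_on_dom_def)
qed

text \<open>
  Vanishing of the pairing on the graph only constrains \<open>x'\<close> and \<open>y'\<close> chosen at the points \<open>x\<close> and
  \<open>y\<close> themselves, whereas orthogonality of the differences of domain and range lets all four vary
  independently. On a product graph there is no distinction.
\<close>

lemma perp_iff_bimonotone_op:
  assumes "gph T = op_dom T \<times> op_range T"
  shows "perp (alg_diff (op_dom T) (op_dom T)) (alg_diff (op_range T) (op_range T))
    \<longleftrightarrow> bimonotone_op T"
proof -
  have mem: "x' \<in> T x \<longleftrightarrow> x \<in> op_dom T \<and> x' \<in> op_range T" for x x'
  proof -
    have "x' \<in> T x \<longleftrightarrow> (x, x') \<in> gph T" by (simp add: gph_def)
    with assms show ?thesis by simp
  qed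
  have "perp (alg_diff (op_dom T) (op_dom T)) (alg_diff (op_range T) (op_range T)) \<longleftrightarrow>
      (\<forall>x \<in> op_dom T. \<forall>y \<in> op_dom T. \<forall>x' \<in> op_range T. \<forall>y' \<in> op_range T.
        pairing (x - y) (x' - y') = 0)"
    unfolding perp_def alg_diff_def by blast
  also have "\<dots> \<longleftrightarrow> bimonotone_op T"
    unfolding bimonotone_op_iff_pairing_zero Ball_def mem by blast
  finally show ?thesis .
qed

text \<open>
  Exchanging the values \<open>x'\<close> and \<open>y'\<close> reverses the sign of \<open>\<langle>x - y, x' - y'\<rangle>\<close>, and an operator
  that is constant on its domain allows this exchange.
\<close>

lemma monotone_constant_imp_bimonotone_op:
  assumes mono: "monotone_op T" and const: "constant_on_dom T"
  shows "bimonotone_op T"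
  unfolding bimonotone_op_iff_pairing_zero
proof (intro allI ballI)
  fix x y x' y'
  assume x': "x' \<in> T x" and y': "y' \<in> T y"
  then have "T x = T y"
    using const by (auto simp: constant_on_dom_def op_dom_def)
  with x' y' have "x' \<in> T y" "y' \<in> T x" by auto
  with x' y' mono have "0 \<le> pairing (x - y) (x' - y')" "0 \<le> pairing (x - y) (y' - x')"
    by (auto simp: monotone_op_iff)
  then show "pairing (x - y) (x' - y') = 0"
    by (simp add: blinfun.diff_left)
qed

text \<open>
  For a bimonotone operator the hypothesis of the exchange property always holds, so the property
  says that any value taken somewhere is taken at every point of the domain.
\<close>

lemma paramonotone_iff_constant_on_dom:
  assumes "bimonotone_op T"
  shows "paramonotone_op T \<longleftrightarrow> constant_on_dom T"
proof -
  have "monotone_op T" using assms by (simp add: bimonotone_op_def)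
  moreover have "pairing (x - y) (x' - y') = 0" if "x' \<in> T x" "y' \<in> T y" for x y x' y'
    using assms that by (simp add: bimonotone_op_iff_pairing_zero)
  ultimately have "paramonotone_op T \<longleftrightarrow>
      (\<forall>x y. \<forall>x' \<in> T x. \<forall>y' \<in> T y. y' \<in> T x \<and> x' \<in> T y)"
    unfolding paramonotone_op_def gph_def by (simp add: Ball_def) blast
  also have "\<dots> \<longleftrightarrow> constant_on_dom T"
    unfolding constant_on_dom_def op_dom_def by blast
  finally show ?thesis .
qed

theorem corollary9:
  fixes T :: "'a::banach operator"
  shows "(paramonotone_op T \<and> bimonotone_op T \<longleftrightarrow> monotone_op T \<and> constant_on_dom T)
    \<and> (monotone_op T \<and> constant_on_dom T \<longleftrightarrow>
         perp (alg_diff (op_dom T) (op_dom T)) (alg_diff (op_range T) (op_range T))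
         \<and> gph T = op_dom T \<times> op_range T)"
proof -
  have "monotone_op T \<and> constant_on_dom T \<longleftrightarrow> bimonotone_op T \<and> constant_on_dom T"
    using monotone_constant_imp_bimonotone_op by (auto simp: bimonotone_op_def)
  then show ?thesis
    using paramonotone_iff_constant_on_dom constant_on_dom_iff_gph_product
      perp_iff_bimonotone_op by blast
qed

end
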